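(* Let $m,k$ be integers with $2\leq k<m$, and let $F=\{D_I\}_{I\in\binom{[m]}{k}}$ be a family of positive real numbers. Suppose there exist $a_1,\ldots,a_{k+1}\in[m]$ such that $$(k-1)D_{a_1,\ldots,a_k}=\sum_{j=1}^{k}D_{a_1,\ldots,\hat a_j,\ldots,a_{k+1}},$$ where $D_{a_1,\ldots,\hat a_j,\ldots,a_{k+1}}$ denotes $D_{\{a_1,\ldots,a_{k+1}\}\setminus\{a_j\}}$. Define the family $F_1=F\cup\{D_{a_i,a_j}\}_{1\leq i<j\leq k+1}$ by $$D_{a_i,a_{k+1}}=D_{a_1,\ldots,a_k}-D_{a_1,\ldots,\hat a_i,\ldots,a_{k+1}}\quad (i\in[k]),$$ $$D_{a_i,a_j}=2D_{a_1,\ldots,a_k}-D_{a_1,\ldots,\hat a_i,\ldots,a_{k+1}}-D_{a_1,\ldots,\hat a_j,\ldots,a_{k+1}}\quad (1\leq i<j\leq k).$$ Then $F$ is positive-treelike if and only if $F_1$ is positive-treelike, and moreover $F$ and $F_1$ are realized by exactly the same positive-weighted trees.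
   Context: All trees are finite. A positive-weighted tree $\mathcal{T}=(T,w)$ is a tree with $w:E(T)\to(0,\infty)$. For vertices $i_1,\ldots,i_r$, the $r$-weight $D_{i_1,\ldots,i_r}(\mathcal{T})$ is the minimum total weight of a connected subtree of $T$ containing $i_1,\ldots,i_r$. A labeled tree has all leaves labeled and possibly some non-leaf vertices labeled (labels from $[m]=\{1,\ldots,m\}$, each used once); it is reduced if every degree-$2$ vertex is labeled. A family of positive numbers indexed by subsets of $[m]$ (here $k$-subsets, and for $F_1$ also some $2$-subsets) is positive-treelike if there exists a labeled reduced positive-weighted tree $\mathcal{T}$ with labels $[m]$ such that each number $D_I$ of the family equals the weight $D_I(\mathcal{T})$ computed on the vertices carrying the labels in $I$; such $\mathcal{T}$ realizes the family. *)

theory Defs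
  imports Complex_Main
begin

text \<open>
  Finite simple undirected graphs are given by a vertex set and a set of edges, each edge
  being a two-element set of vertices.
\<close>

definition simple_graph :: "'v set \<Rightarrow> 'v set set \<Rightarrow> bool" where
  "simple_graph V E \<longleftrightarrow> finite V \<and> (\<forall>e\<in>E. e \<subseteq> V \<and> card e = 2)"

definition connected_graph :: "'v set \<Rightarrow> 'v set set \<Rightarrow> bool" where
  "connected_graph V E \<longleftrightarrow>
     V \<noteq> {} \<and> (\<forall>u\<in>V. \<forall>v\<in>V. (u, v) \<in> {(x, y). {x, y} \<in> E}\<^sup>*)"

definition graph_cycle :: "'v set set \<Rightarrow> 'v list \<Rightarrow> bool" where
  "graph_cycle E vs \<longleftrightarrow>
     3 \<le> length vs \<and> distinct vs \<and>
     (\<forall>i<length vs. {vs ! i, vs ! (Suc i mod length vs)} \<in> E)"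

definition tree :: "'v set \<Rightarrow> 'v set set \<Rightarrow> bool" where
  "tree V E \<longleftrightarrow> simple_graph V E \<and> connected_graph V E \<and> (\<nexists>vs. graph_cycle E vs)"

definition degree :: "'v set set \<Rightarrow> 'v \<Rightarrow> nat" where
  "degree E v = card {e \<in> E. v \<in> e}"

text \<open>
  A weighted tree with labels: the vertex carrying the label \<open>i\<close> is \<open>lab T i\<close>. Weights of
  non-edges and labels outside \<open>{1..m}\<close> are irrelevant.
\<close>

record 'v labeled_tree =
  verts :: "'v set"
  edges :: "'v set set"
  weight :: "'v set \<Rightarrow> real"
  lab :: "nat \<Rightarrow> 'v"

definition positive_weighted_tree :: "'v labeled_tree \<Rightarrow> bool" where
  "positive_weighted_tree T \<longleftrightarrow>
     tree (verts T) (edges T) \<and> (\<forall>e\<in>edges T. 0 < weight T e)"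

definition labeled :: "nat \<Rightarrow> 'v labeled_tree \<Rightarrow> bool" where
  "labeled m T \<longleftrightarrow>
     inj_on (lab T) {1..m} \<and> lab T ` {1..m} \<subseteq> verts T \<and>
     (\<forall>v\<in>verts T. degree (edges T) v = 1 \<longrightarrow> v \<in> lab T ` {1..m})"

definition reduced :: "nat \<Rightarrow> 'v labeled_tree \<Rightarrow> bool" where
  "reduced m T \<longleftrightarrow>
     (\<forall>v\<in>verts T. degree (edges T) v = 2 \<longrightarrow> v \<in> lab T ` {1..m})"

text \<open>
  For a finite tree and a set of its vertices, the minimum below is over a finite nonempty set.
\<close>

definition r_weight :: "'v labeled_tree \<Rightarrow> 'v set \<Rightarrow> real" where
  "r_weight T S = Min {\<Sum>e\<in>E'. weight T e | V' E'.
     V' \<subseteq> verts T \<and> E' \<subseteq> edges T \<and> tree V' E' \<and> S \<subseteq> V'}"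

text \<open>
  A family of numbers indexed by sets of labels is represented by its set of pairs (index, value).
\<close>

type_synonym family = "(nat set \<times> real) set"

definition realizes :: "nat \<Rightarrow> 'v labeled_tree \<Rightarrow> family \<Rightarrow> bool" where
  "realizes m T F \<longleftrightarrow>
     positive_weighted_tree T \<and> labeled m T \<and> reduced m T \<and>
     (\<forall>(I, d)\<in>F. d = r_weight T (lab T ` I))"

text \<open>
  Every finite tree is isomorphic to one whose vertices are natural numbers, so it is no
  restriction to let the existential quantifier range over trees on vertices of type \<open>nat\<close>.
\<close>

definition positive_treelike :: "nat \<Rightarrow> family \<Rightarrow> bool" where
  "positive_treelike m F \<longleftrightarrow>
     (\<forall>(I, d)\<in>F. 0 < d) \<and> (\<exists>T :: nat labeled_tree. realizes m T F)"

definition subset_family :: "nat \<Rightarrow> nat \<Rightarrow> (nat set \<Rightarrow> real) \<Rightarrow> family" where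
  "subset_family m k D = {(I, D I) | I. I \<subseteq> {1..m} \<and> card I = k}"

text \<open>
  For \<open>k = 2\<close> the added pairs are already indices of \<open>subset_family m k D\<close>; under the relation
  assumed on \<open>a\<close> in the theorem the added values are then the ones already present.
\<close>

definition extended_family ::
    "nat \<Rightarrow> nat \<Rightarrow> (nat set \<Rightarrow> real) \<Rightarrow> (nat \<Rightarrow> nat) \<Rightarrow> family" where
  "extended_family m k D a =
     subset_family m k D
     \<union> {({a i, a (k + 1)}, D (a ` {1..k}) - D (a ` {1..k+1} - {a i})) | i. i \<in> {1..k}}
     \<union> {({a i, a j},
          2 * D (a ` {1..k}) - D (a ` {1..k+1} - {a i}) - D (a ` {1..k+1} - {a j}))
         | i j. 1 \<le> i \<and> i < j \<and> j \<le> k}"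

end

theory Submission
  imports Defs "HOL-Library.Transitive_Closure_Table"
begin

text \<open>
  The weight of the minimal subtree spanning \<open>S\<close> is the total weight of the edges whose removal
  separates two points of \<open>S\<close>. Let \<open>s\<close> be the number of labels among \<open>a\<^sub>1, \<dots>, a\<^sub>k\<close> that an edge
  \<open>e\<close> cuts off from \<open>c = a\<^sub>k\<^sub>+\<^sub>1\<close>. Then \<open>e\<close> contributes to the right-hand side minus the
  left-hand side of the hypothesis \<open>0\<close> if \<open>s \<le> 1\<close>, \<open>1\<close> if \<open>1 < s < k\<close>, and \<open>k\<close> if \<open>s = k\<close>,
  times its weight. As weights are positive, the hypothesis forces \<open>s \<le> 1\<close> for all edges: the
  subtree spanned by the \<open>a\<^sub>i\<close> is a star of paths centred at \<open>c\<close>. In such a star the formula for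
  the weight of \<open>{a\<^sub>i, c}\<close> holds edge by edge, and the path from \<open>a\<^sub>i\<close> to \<open>a\<^sub>j\<close> passes through \<open>c\<close>.
\<close>

section \<open>Linked vertices\<close>

definition linked :: "'v set set \<Rightarrow> ('v \<times> 'v) set" where
  "linked E = {(x, y). {x, y} \<in> E}\<^sup>*"

lemma linked_refl [simp]: "(x, x) \<in> linked E"
  by (simp add: linked_def)

lemma linked_trans: "(x, y) \<in> linked E \<Longrightarrow> (y, z) \<in> linked E \<Longrightarrow> (x, z) \<in> linked E"
  unfolding linked_def by (rule rtrancl_trans)

lemma linked_sym: "(x, y) \<in> linked E \<Longrightarrow> (y, x) \<in> linked E"
proof -
  have "sym {(x, y). {x, y} \<in> E}"
    by (auto intro!: symI simp: insert_commute)
  then show "(x, y) \<in> linked E \<Longrightarrow> (y, x) \<in> linked E"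
    unfolding linked_def by (meson sym_rtrancl symD)
qed

lemma linked_edge: "{x, y} \<in> E \<Longrightarrow> (x, y) \<in> linked E"
  unfolding linked_def by auto

lemma linked_mono: "A \<subseteq> B \<Longrightarrow> linked A \<subseteq> linked B"
  unfolding linked_def by (rule rtrancl_mono) auto

lemma linked_empty: "linked {} = Id"
  by (simp add: linked_def)

lemma connected_graph_iff_linked: "connected_graph V E \<longleftrightarrow> V \<noteq> {} \<and> V \<times> V \<subseteq> linked E"
  unfolding connected_graph_def linked_def by blast

lemma linked_Diff_edge_cases:
  assumes "(u, v) \<in> linked E"
  shows "(u, v) \<in> linked (E - {{x, y}}) \<or>
    (u, x) \<in> linked (E - {{x, y}}) \<and> (y, v) \<in> linked (E - {{x, y}}) \<or>
    (u, y) \<in> linked (E - {{x, y}}) \<and> (x, v) \<in> linked (E - {{x, y}})"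
  using assms unfolding linked_def
proof (induction rule: rtrancl_induct)
  case base
  then show ?case by simp
next
  case (step v w)
  show ?case
  proof (cases "{v, w} = {x, y}")
    case True
    then have "v = x \<and> w = y \<or> v = y \<and> w = x"
      by (auto simp: doubleton_eq_iff)
    with step.IH show ?thesis by auto
  next
    case False
    with step.hyps(2) have "(v, w) \<in> {(p, q). {p, q} \<in> E - {{x, y}}}"
      by auto
    with step.IH show ?thesis
      by (meson rtrancl.rtrancl_into_rtrancl)
  qed
qed

lemma linked_endpoint_of_separating_edge:
  assumes "(u, v) \<in> linked E" and "(u, v) \<notin> linked (E - {{x, y}})" and "{x, y} \<in> E"
    and "z \<in> {x, y}"
  shows "(u, z) \<in> linked E"
proof -
  have "(u, x) \<in> linked (E - {{x, y}}) \<or> (u, y) \<in> linked (E - {{x, y}})"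
    using linked_Diff_edge_cases[OF assms(1)] assms(2) by blast
  then have "(u, x) \<in> linked E \<or> (u, y) \<in> linked E"
    using linked_mono[of "E - {{x, y}}" E] by blast
  with linked_edge[OF assms(3)] assms(4) show ?thesis
    by (auto intro: linked_trans linked_sym)
qed

lemma not_linked_Diff_edge_if_no_cycle:
  assumes no_cycle: "\<nexists>vs. graph_cycle E vs" and edge: "{x, y} \<in> E" and "x \<noteq> y"
  shows "(x, y) \<notin> linked (E - {{x, y}})"
proof
  let ?adj = "\<lambda>u v. {u, v} \<in> E - {{x, y}}"
  assume "(x, y) \<in> linked (E - {{x, y}})"
  then have "?adj\<^sup>*\<^sup>* x y"
    by (simp add: linked_def rtranclp_rtrancl_eq)
  then obtain p where path: "rtrancl_path ?adj x p y" and dist: "distinct (x # p)"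
    by (metis rtranclp_eq_rtrancl_path rtrancl_path_distinct)
  have step: "?adj ((x # p) ! i) (p ! i)" if "i < length p" for i
    using rtrancl_path_nth[OF path that] .
  have "p \<noteq> []"
    using path \<open>x \<noteq> y\<close> by (auto elim: rtrancl_path.cases)
  then have final: "p ! (length p - 1) = y"
    using rtrancl_path_last[OF path] by (simp add: last_conv_nth)
  have "length p \<noteq> 1"
    using final step[of 0] \<open>p \<noteq> []\<close> by auto
  with \<open>p \<noteq> []\<close> have "3 \<le> length (x # p)"
    by (cases p) (auto simp: Suc_le_eq)
  moreover have "{(x # p) ! i, (x # p) ! (Suc i mod length (x # p))} \<in> E"
    if "i < length (x # p)" for i
  proof (cases "i < length p")
    case True
    then show ?thesis using step[of i] by simp
  next
    case False
    with that have "i = length p" by simp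
    then show ?thesis
      using final edge \<open>p \<noteq> []\<close> by (simp add: insert_commute nth_Cons')
  qed
  ultimately have "graph_cycle E (x # p)"
    using dist unfolding graph_cycle_def by blast
  with no_cycle show False by blast
qed

section \<open>Separating edges of a tree\<close>

lemma tree_edgeE:
  assumes "tree V E" and "e \<in> E"
  obtains x y where "e = {x, y}" and "x \<noteq> y"
  using assms unfolding tree_def simple_graph_def by (meson card_2_iff)

lemma tree_linked: "tree V E \<Longrightarrow> u \<in> V \<Longrightarrow> v \<in> V \<Longrightarrow> (u, v) \<in> linked E"
  unfolding tree_def connected_graph_iff_linked by blast

lemma tree_finite_edges: "tree V E \<Longrightarrow> finite E"
  unfolding tree_def simple_graph_def
  by (rule finite_subset[of _ "Pow V"]) auto

lemma tree_Union_edges_subset: "tree V E \<Longrightarrow> \<Union>E \<subseteq> V"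
  unfolding tree_def simple_graph_def by blast

lemma tree_subgraph:
  assumes "tree V E" and "V' \<subseteq> V" and "E' \<subseteq> E" and "\<Union>E' \<subseteq> V'" and "connected_graph V' E'"
  shows "tree V' E'"
  unfolding tree_def
proof (intro conjI)
  show "simple_graph V' E'"
    using assms by (auto simp: tree_def simple_graph_def intro: finite_subset)
  show "\<nexists>vs. graph_cycle E' vs"
    using assms(1,3) unfolding tree_def graph_cycle_def by (meson subsetD)
qed fact

lemma tree_linked_Diff_edge:
  assumes "tree V E" and "A \<subseteq> E" and "e \<in> E"
    and "(u, v) \<in> linked A" and "(u, v) \<in> linked (E - {e})"
  shows "(u, v) \<in> linked (A - {e})"
proof -
  obtain x y where e: "e = {x, y}" and "x \<noteq> y"
    using assms(1,3) by (rule tree_edgeE)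
  have "(x, y) \<notin> linked (E - {e})"
    using not_linked_Diff_edge_if_no_cycle[of E x y] assms(1,3) \<open>x \<noteq> y\<close> e by (simp add: tree_def)
  moreover have "linked (A - {e}) \<subseteq> linked (E - {e})"
    using assms(2) by (intro linked_mono) blast
  ultimately show ?thesis
    using linked_Diff_edge_cases[OF assms(4), of x y] assms(5)
    unfolding e[symmetric] by (meson subsetD linked_sym linked_trans)
qed

lemma tree_linked_subgraph_iff:
  assumes "tree V E" and "A \<subseteq> E" and "u \<in> V" and "v \<in> V"
  shows "(u, v) \<in> linked A \<longleftrightarrow> (\<forall>e\<in>E - A. (u, v) \<in> linked (E - {e}))"
proof
  assume linked_A: "(u, v) \<in> linked A"
  show "\<forall>e\<in>E - A. (u, v) \<in> linked (E - {e})"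
  proof
    fix e assume "e \<in> E - A"
    then have "linked A \<subseteq> linked (E - {e})"
      using assms(2) by (intro linked_mono) blast
    with linked_A show "(u, v) \<in> linked (E - {e})" by blast
  qed
next
  have linked_Diff: "(u, v) \<in> linked (E - R)"
    if "finite R" "R \<subseteq> E" "\<forall>e\<in>R. (u, v) \<in> linked (E - {e})" for R
    using that
  proof (induction R rule: finite_induct)
    case empty
    then show ?case using tree_linked[OF assms(1,3,4)] by simp
  next
    case (insert e R)
    then have "e \<in> E" "(u, v) \<in> linked (E - R)" "(u, v) \<in> linked (E - {e})"
      by auto
    then have "(u, v) \<in> linked (E - R - {e})"
      using tree_linked_Diff_edge[OF assms(1)] by blast
    then show ?case by (subst Diff_insert)
  qed
  assume "\<forall>e\<in>E - A. (u, v) \<in> linked (E - {e})"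
  then have "(u, v) \<in> linked (E - (E - A))"
    using tree_finite_edges[OF assms(1)] by (intro linked_Diff) auto
  then show "(u, v) \<in> linked A"
    using assms(2) by (simp add: double_diff)
qed

definition separating_edges :: "'v set set \<Rightarrow> 'v set \<Rightarrow> 'v set set" where
  "separating_edges E S = {e \<in> E. \<not> S \<times> S \<subseteq> linked (E - {e})}"

lemma separating_edges_subset: "separating_edges E S \<subseteq> E"
  by (auto simp: separating_edges_def)

lemma tree_separating_edges_verts_subset:
  assumes "tree V E" and "S \<subseteq> V"
  shows "S \<union> \<Union>(separating_edges E S) \<subseteq> V"
  using assms(2) tree_Union_edges_subset[OF assms(1)] separating_edges_subset[of E S] by blast

lemma tree_Times_subset_linked_iff:
  assumes "tree V E" and "A \<subseteq> E" and "S \<subseteq> V"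
  shows "S \<times> S \<subseteq> linked A \<longleftrightarrow> separating_edges E S \<subseteq> A"
proof -
  have "S \<times> S \<subseteq> linked A \<longleftrightarrow> (\<forall>u\<in>S. \<forall>v\<in>S. \<forall>e\<in>E - A. (u, v) \<in> linked (E - {e}))"
    using tree_linked_subgraph_iff[OF assms(1,2)] assms(3) by blast
  also have "\<dots> \<longleftrightarrow> separating_edges E S \<subseteq> A"
    unfolding separating_edges_def by blast
  finally show ?thesis .
qed

lemma tree_separating_edges:
  assumes "tree V E" and "S \<subseteq> V" and "S \<noteq> {}"
  shows "tree (S \<union> \<Union>(separating_edges E S)) (separating_edges E S)"
proof (rule tree_subgraph[OF assms(1)])
  let ?sep = "separating_edges E S"
  show "S \<union> \<Union>?sep \<subseteq> V"
    using assms(1,2) by (rule tree_separating_edges_verts_subset)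
  have linked_S: "S \<times> S \<subseteq> linked ?sep"
    by (simp add: tree_Times_subset_linked_iff[OF assms(1) separating_edges_subset assms(2)])
  have linked_to_S: "\<exists>u\<in>S. (u, z) \<in> linked ?sep" if "z \<in> S \<union> \<Union>?sep" for z
  proof (cases "z \<in> S")
    case True
    then show ?thesis by (intro bexI[of _ z]) simp
  next
    case False
    with that obtain e where e: "e \<in> ?sep" "z \<in> e" by blast
    obtain u v where "u \<in> S" "v \<in> S" and separated: "(u, v) \<notin> linked (E - {e})"
      using e(1) unfolding separating_edges_def by blast
    obtain x y where xy: "e = {x, y}"
      using assms(1) e(1) separating_edges_subset by (metis tree_edgeE subsetD)
    have "(u, v) \<in> linked ?sep"
      using linked_S \<open>u \<in> S\<close> \<open>v \<in> S\<close> by blast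
    moreover have "(u, v) \<notin> linked (?sep - {e})"
      using separated linked_mono[of "?sep - {e}" "E - {e}"] separating_edges_subset[of E S]
      by blast
    ultimately have "(u, z) \<in> linked ?sep"
      using e unfolding xy by (rule linked_endpoint_of_separating_edge)
    with \<open>u \<in> S\<close> show ?thesis by blast
  qed
  have "(z, z') \<in> linked ?sep" if z: "z \<in> S \<union> \<Union>?sep" and z': "z' \<in> S \<union> \<Union>?sep" for z z'
  proof -
    obtain u u' where "u \<in> S" "u' \<in> S" "(u, z) \<in> linked ?sep" "(u', z') \<in> linked ?sep"
      using linked_to_S[OF z] linked_to_S[OF z'] by blast
    then show ?thesis using linked_S by (meson SigmaI subsetD linked_sym linked_trans)
  qed
  then show "connected_graph (S \<union> \<Union>?sep) ?sep"
    using assms(3) unfolding connected_graph_iff_linked by blast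
qed (use separating_edges_subset in auto)

section \<open>Weights of spanned subtrees\<close>

lemma r_weight_eq_sum_separating_edges:
  assumes tree: "tree (verts T) (edges T)" and nonneg: "\<And>e. e \<in> edges T \<Longrightarrow> 0 \<le> weight T e"
    and verts: "S \<subseteq> verts T" and "S \<noteq> {}"
  shows "r_weight T S = sum (weight T) (separating_edges (edges T) S)"
  unfolding r_weight_def
proof (rule Min_eqI)
  let ?sep = "separating_edges (edges T) S"
  let ?subtree_weights = "{sum (weight T) E' | V' E'.
    V' \<subseteq> verts T \<and> E' \<subseteq> edges T \<and> tree V' E' \<and> S \<subseteq> V'}"
  have finite: "finite (edges T)" using tree by (rule tree_finite_edges)
  then show "finite ?subtree_weights"
    by (auto intro: finite_subset[of _ "sum (weight T) ` Pow (edges T)"])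
  show "sum (weight T) ?sep \<in> ?subtree_weights"
    using tree_separating_edges[OF tree verts \<open>S \<noteq> {}\<close>]
      tree_separating_edges_verts_subset[OF tree verts] separating_edges_subset[of "edges T" S]
    by blast
  fix d assume "d \<in> ?subtree_weights"
  then obtain V' E' where d: "d = sum (weight T) E'"
    and subset: "E' \<subseteq> edges T" and "tree V' E'" and "S \<subseteq> V'" by blast
  then have "S \<times> S \<subseteq> linked E'"
    by (auto intro: tree_linked)
  then have "?sep \<subseteq> E'"
    using tree_Times_subset_linked_iff[OF tree subset verts] by simp
  moreover have "finite E'"
    using subset finite by (rule finite_subset)
  moreover have "0 \<le> weight T e" if "e \<in> E'" for e
    using subset that by (intro nonneg) blast
  ultimately show "sum (weight T) ?sep \<le> d"
    unfolding d by (intro sum_mono2) auto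
qed

lemma positive_weighted_treeD:
  assumes "positive_weighted_tree T"
  shows "tree (verts T) (edges T)" and "e \<in> edges T \<Longrightarrow> 0 < weight T e"
  using assms by (auto simp: positive_weighted_tree_def)

lemma r_weight_pos:
  assumes positive: "positive_weighted_tree T" and verts: "S \<subseteq> verts T" and card: "2 \<le> card S"
  shows "0 < r_weight T S"
proof -
  let ?sep = "separating_edges (edges T) S"
  note tree = positive_weighted_treeD(1)[OF positive]
    and pos = positive_weighted_treeD(2)[OF positive]
  have "finite S" and "S \<noteq> {}"
    using card by (auto intro: card_ge_0_finite)
  then have "\<exists>u\<in>S. \<exists>v\<in>S. u \<noteq> v"
    using card card_le_Suc0_iff_eq[of S] by fastforce
  then have "\<not> S \<times> S \<subseteq> linked {}"
    by (auto simp: linked_empty)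
  then have "?sep \<noteq> {}"
    using tree_Times_subset_linked_iff[OF tree _ verts, of "{}"] by simp
  moreover have "finite ?sep"
    using separating_edges_subset tree_finite_edges[OF tree] by (rule finite_subset)
  ultimately have "0 < sum (weight T) ?sep"
    using pos separating_edges_subset[of "edges T" S] by (intro sum_pos) auto
  then show ?thesis
    using r_weight_eq_sum_separating_edges[OF tree less_imp_le[OF pos] verts \<open>S \<noteq> {}\<close>] by simp
qed

section \<open>The two sides of an edge\<close>

definition far_side :: "'v set set \<Rightarrow> 'v \<Rightarrow> 'v set \<Rightarrow> 'v set" where
  "far_side E c e = {v. (c, v) \<notin> linked (E - {e})}"

lemma base_notin_far_side [simp]: "c \<notin> far_side E c e"
  by (simp add: far_side_def)

lemma separating_edges_pair: "separating_edges E {c, x} = {e \<in> E. x \<in> far_side E c e}"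
  unfolding separating_edges_def far_side_def by (auto dest: linked_sym)

lemma tree_linked_Diff_edge_iff_same_side:
  assumes "tree V E" and "e \<in> E" and "c \<in> V" and "u \<in> V" and "v \<in> V"
  shows "(u, v) \<in> linked (E - {e}) \<longleftrightarrow> (u \<in> far_side E c e \<longleftrightarrow> v \<in> far_side E c e)"
proof -
  obtain x y where e: "e = {x, y}" using assms(1,2) by (rule tree_edgeE)
  have "(c, u) \<in> linked E" "(c, v) \<in> linked E"
    using assms by (simp_all add: tree_linked)
  then show ?thesis
    using linked_Diff_edge_cases[of c u E x y] linked_Diff_edge_cases[of c v E x y]
    unfolding far_side_def e[symmetric] mem_Collect_eq by (meson linked_sym linked_trans)
qed

definition splits :: "'a set \<Rightarrow> 'a set \<Rightarrow> bool" where
  "splits P S \<longleftrightarrow> S \<inter> P \<noteq> {} \<and> \<not> S \<subseteq> P"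

lemma splits_pair: "splits P {x, y} \<longleftrightarrow> (x \<in> P) \<noteq> (y \<in> P)"
  by (auto simp: splits_def)

lemma splits_insert_Diff:
  assumes "c \<notin> P" and "c \<noteq> x"
  shows "splits P (insert c S - {x}) \<longleftrightarrow> \<not> S \<inter> P \<subseteq> {x}"
  using assms by (auto simp: splits_def)

lemma tree_separating_edges_eq_splits:
  assumes "tree V E" and "c \<in> V" and "S \<subseteq> V"
  shows "separating_edges E S = {e \<in> E. splits (far_side E c e) S}"
proof -
  have "S \<times> S \<subseteq> linked (E - {e}) \<longleftrightarrow> \<not> splits (far_side E c e) S" if "e \<in> E" for e
  proof -
    have "S \<times> S \<subseteq> linked (E - {e}) \<longleftrightarrow>
        (\<forall>u\<in>S. \<forall>v\<in>S. u \<in> far_side E c e \<longleftrightarrow> v \<in> far_side E c e)"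
      using tree_linked_Diff_edge_iff_same_side[OF assms(1) that assms(2)] assms(3) by blast
    also have "\<dots> \<longleftrightarrow> \<not> splits (far_side E c e) S"
      unfolding splits_def by blast
    finally show ?thesis .
  qed
  then show ?thesis unfolding separating_edges_def by blast
qed

lemma r_weight_eq_sum_splits:
  assumes positive: "positive_weighted_tree T" and "c \<in> verts T"
    and verts: "S \<subseteq> verts T" and "S \<noteq> {}"
  shows "r_weight T S = (\<Sum>e\<in>edges T. weight T e * of_bool (splits (far_side (edges T) c e) S))"
proof -
  note tree = positive_weighted_treeD(1)[OF positive]
    and pos = positive_weighted_treeD(2)[OF positive]
  have "r_weight T S = sum (weight T) {e \<in> edges T. splits (far_side (edges T) c e) S}"
    using r_weight_eq_sum_separating_edges[OF tree less_imp_le[OF pos] verts \<open>S \<noteq> {}\<close>]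
      tree_separating_edges_eq_splits[OF tree \<open>c \<in> verts T\<close> verts] by simp
  then show ?thesis
    using tree_finite_edges[OF tree] by (simp add: Collect_conj_eq)
qed

section \<open>Stars\<close>

definition star_excess :: "'a set \<Rightarrow> 'a set \<Rightarrow> real" where
  "star_excess P S = (if card (S \<inter> P) \<le> 1 then 0 else if S \<subseteq> P then real (card S) else 1)"

lemma star_excess_nonneg: "0 \<le> star_excess P S"
  by (simp add: star_excess_def)

lemma star_excess_eq_0_iff: "star_excess P S = 0 \<longleftrightarrow> card (S \<inter> P) \<le> 1"
  by (auto simp: star_excess_def Int_absorb2)

lemma sum_splits_eq_star_excess:
  assumes "finite S" and "2 \<le> card S" and "c \<notin> S" and "c \<notin> P"
  shows "(\<Sum>x\<in>S. of_bool (splits P (insert c S - {x})))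
    - (real (card S) - 1) * of_bool (splits P S) = star_excess P S"
proof -
  have "splits P (insert c S - {x}) \<longleftrightarrow> \<not> S \<inter> P \<subseteq> {x}" if "x \<in> S" for x
    using that assms(3,4) by (intro splits_insert_Diff) auto
  then have "(\<Sum>x\<in>S. of_bool (splits P (insert c S - {x}))) =
      (\<Sum>x\<in>S. of_bool (\<not> S \<inter> P \<subseteq> {x}) :: real)"
    by (simp cong: sum.cong)
  also have "\<dots> = real (card {x \<in> S. \<not> S \<inter> P \<subseteq> {x}})"
    using assms(1) by (simp add: Collect_conj_eq)
  finally have count: "(\<Sum>x\<in>S. of_bool (splits P (insert c S - {x}))) =
      real (card {x \<in> S. \<not> S \<inter> P \<subseteq> {x}})" .
  consider (none) "S \<inter> P = {}" | (one) p where "S \<inter> P = {p}" | (many) "\<not> card (S \<inter> P) \<le> 1"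
    by (metis One_nat_def assms(1) card_1_singleton_iff card_0_eq finite_Int le_Suc_eq le_zero_eq)
  then show ?thesis
  proof cases
    case none
    then show ?thesis unfolding count by (simp add: splits_def star_excess_def)
  next
    case one
    then have "{x \<in> S. \<not> S \<inter> P \<subseteq> {x}} = S - {p}" and "p \<in> S" by auto
    moreover have "\<not> S \<subseteq> P"
      using one assms(2) by (auto simp: Int_absorb2)
    ultimately show ?thesis
      using one assms(1,2) unfolding count by (simp add: splits_def star_excess_def)
  next
    case many
    have "\<not> S \<inter> P \<subseteq> {x}" for x
      using many card_mono[of "{x}" "S \<inter> P"] by auto
    then show ?thesis
      using many unfolding count by (auto simp: splits_def star_excess_def)
  qed
qed

lemma sum_r_weight_eq_star_excess:
  assumes positive: "positive_weighted_tree T" and verts: "S \<subseteq> verts T" and card: "2 \<le> card S"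
    and "c \<in> verts T" and "c \<notin> S"
  shows "(\<Sum>x\<in>S. r_weight T (insert c S - {x})) - (real (card S) - 1) * r_weight T S =
    (\<Sum>e\<in>edges T. weight T e * star_excess (far_side (edges T) c e) S)"
proof -
  let ?split = "\<lambda>e R. of_bool (splits (far_side (edges T) c e) R) :: real"
  note r_weight = r_weight_eq_sum_splits[OF positive \<open>c \<in> verts T\<close>]
  have "finite S"
    using card by (auto intro: card_ge_0_finite)
  have "r_weight T S = (\<Sum>e\<in>edges T. weight T e * ?split e S)"
    using verts card by (intro r_weight) auto
  moreover have "(\<Sum>x\<in>S. r_weight T (insert c S - {x})) =
      (\<Sum>e\<in>edges T. weight T e * (\<Sum>x\<in>S. ?split e (insert c S - {x})))"
  proof -
    have "r_weight T (insert c S - {x}) =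
        (\<Sum>e\<in>edges T. weight T e * ?split e (insert c S - {x}))" if "x \<in> S" for x
      using verts \<open>c \<in> verts T\<close> \<open>c \<notin> S\<close> that by (intro r_weight) auto
    then have "(\<Sum>x\<in>S. r_weight T (insert c S - {x})) =
        (\<Sum>x\<in>S. \<Sum>e\<in>edges T. weight T e * ?split e (insert c S - {x}))"
      by (rule sum.cong[OF refl])
    then show ?thesis
      by (subst (asm) sum.swap) (simp only: sum_distrib_left)
  qed
  ultimately have "(\<Sum>x\<in>S. r_weight T (insert c S - {x})) - (real (card S) - 1) * r_weight T S =
      (\<Sum>e\<in>edges T. weight T e *
        ((\<Sum>x\<in>S. ?split e (insert c S - {x})) - (real (card S) - 1) * ?split e S))"
    by (simp only: sum_distrib_left right_diff_distrib sum_subtractf mult.left_commute)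
  then show ?thesis
    by (simp only: sum_splits_eq_star_excess[OF \<open>finite S\<close> card \<open>c \<notin> S\<close> base_notin_far_side])
qed

text \<open>\<open>separating_edges E {c, x}\<close> is the edge set of the path from \<open>c\<close> to \<open>x\<close>.\<close>

definition star_centre :: "'v set set \<Rightarrow> 'v \<Rightarrow> 'v set \<Rightarrow> bool" where
  "star_centre E c S \<longleftrightarrow>
     pairwise (\<lambda>x y. disjnt (separating_edges E {c, x}) (separating_edges E {c, y})) S"

lemma star_centre_iff_card_far_side:
  assumes "finite S"
  shows "star_centre E c S \<longleftrightarrow> (\<forall>e\<in>E. card (S \<inter> far_side E c e) \<le> 1)"
proof -
  have "star_centre E c S \<longleftrightarrow>
      (\<forall>e\<in>E. \<forall>x\<in>S \<inter> far_side E c e. \<forall>y\<in>S \<inter> far_side E c e. x = y)"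
    unfolding star_centre_def pairwise_def disjnt_def separating_edges_pair by blast
  also have "\<dots> \<longleftrightarrow> (\<forall>e\<in>E. card (S \<inter> far_side E c e) \<le> 1)"
    using assms by (simp add: card_le_Suc0_iff_eq)
  finally show ?thesis .
qed

lemma star_centre_iff_sum_r_weight:
  assumes positive: "positive_weighted_tree T" and verts: "S \<subseteq> verts T" and card: "2 \<le> card S"
    and "c \<in> verts T" and "c \<notin> S"
  shows "star_centre (edges T) c S \<longleftrightarrow>
    (real (card S) - 1) * r_weight T S = (\<Sum>x\<in>S. r_weight T (insert c S - {x}))"
proof -
  let ?excess = "\<lambda>e. star_excess (far_side (edges T) c e) S"
  note tree = positive_weighted_treeD(1)[OF positive]
    and pos = positive_weighted_treeD(2)[OF positive]
  have "finite S"
    using card by (auto intro: card_ge_0_finite)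
  have "(real (card S) - 1) * r_weight T S = (\<Sum>x\<in>S. r_weight T (insert c S - {x})) \<longleftrightarrow>
      (\<Sum>e\<in>edges T. weight T e * ?excess e) = 0"
    using sum_r_weight_eq_star_excess[OF assms] by linarith
  also have "\<dots> \<longleftrightarrow> (\<forall>e\<in>edges T. weight T e * ?excess e = 0)"
    using tree_finite_edges[OF tree] pos
    by (intro sum_nonneg_eq_0_iff) (auto simp: less_imp_le star_excess_nonneg)
  also have "\<dots> \<longleftrightarrow> (\<forall>e\<in>edges T. card (S \<inter> far_side (edges T) c e) \<le> 1)"
    using pos by (force simp: star_excess_eq_0_iff)
  also have "\<dots> \<longleftrightarrow> star_centre (edges T) c S"
    using star_centre_iff_card_far_side[OF \<open>finite S\<close>] by blast
  finally show ?thesis by blast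
qed

lemma of_bool_splits_spoke:
  assumes "finite S" and "2 \<le> card S" and "card (S \<inter> P) \<le> 1" and "x \<in> S" and "c \<notin> S" and "c \<notin> P"
  shows "of_bool (splits P {c, x}) =
    (of_bool (splits P S) - of_bool (splits P (insert c S - {x})) :: 'b::ring_1)"
proof -
  have "\<not> S \<subseteq> P"
    using assms(2,3) by (auto simp: Int_absorb2)
  then have "splits P S \<longleftrightarrow> S \<inter> P \<noteq> {}"
    by (simp add: splits_def)
  moreover have "splits P (insert c S - {x}) \<longleftrightarrow> \<not> S \<inter> P \<subseteq> {x}"
    using assms(4-6) by (intro splits_insert_Diff) auto
  moreover have "\<forall>y\<in>S \<inter> P. \<forall>z\<in>S \<inter> P. y = z"
    using assms(1,3) by (simp add: card_le_Suc0_iff_eq)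
  ultimately show ?thesis
    using assms(4,6) by (auto simp: splits_pair)
qed

lemma star_centre_r_weight_spoke:
  assumes positive: "positive_weighted_tree T" and verts: "S \<subseteq> verts T" and card: "2 \<le> card S"
    and "c \<in> verts T" and "c \<notin> S" and star: "star_centre (edges T) c S" and "x \<in> S"
  shows "r_weight T {c, x} = r_weight T S - r_weight T (insert c S - {x})"
proof -
  let ?split = "\<lambda>e R. of_bool (splits (far_side (edges T) c e) R) :: real"
  note r_weight = r_weight_eq_sum_splits[OF positive \<open>c \<in> verts T\<close>]
  have "finite S"
    using card by (auto intro: card_ge_0_finite)
  have "?split e {c, x} = ?split e S - ?split e (insert c S - {x})" if "e \<in> edges T" for e
  proof (rule of_bool_splits_spoke)
    show "card (S \<inter> far_side (edges T) c e) \<le> 1"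
      using star that star_centre_iff_card_far_side[OF \<open>finite S\<close>] by blast
  qed (simp_all add: \<open>finite S\<close> card \<open>x \<in> S\<close> \<open>c \<notin> S\<close>)
  then have "(\<Sum>e\<in>edges T. weight T e * ?split e {c, x}) =
      (\<Sum>e\<in>edges T. weight T e * ?split e S)
      - (\<Sum>e\<in>edges T. weight T e * ?split e (insert c S - {x}))"
    by (simp add: right_diff_distrib flip: sum_subtractf)
  moreover have "r_weight T R = (\<Sum>e\<in>edges T. weight T e * ?split e R)"
    if "R \<in> {{c, x}, S, insert c S - {x}}" for R
    using that verts \<open>c \<in> verts T\<close> \<open>c \<notin> S\<close> \<open>x \<in> S\<close> by (intro r_weight) auto
  ultimately show ?thesis by simp
qed

lemma star_centre_r_weight_pair:
  assumes positive: "positive_weighted_tree T" and verts: "S \<subseteq> verts T" and "c \<in> verts T"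
    and star: "star_centre (edges T) c S" and "x \<in> S" and "y \<in> S" and "x \<noteq> y"
  shows "r_weight T {x, y} = r_weight T {c, x} + r_weight T {c, y}"
proof -
  let ?sep = "separating_edges (edges T)"
  note tree = positive_weighted_treeD(1)[OF positive]
    and pos = positive_weighted_treeD(2)[OF positive]
  have in_verts: "x \<in> verts T" "y \<in> verts T"
    using verts \<open>x \<in> S\<close> \<open>y \<in> S\<close> by auto
  have r_weight: "r_weight T {u, v} = sum (weight T) (?sep {u, v})"
    if "u \<in> verts T" "v \<in> verts T" for u v
    using that by (intro r_weight_eq_sum_separating_edges[OF tree less_imp_le[OF pos]]) auto
  have disjoint: "?sep {c, x} \<inter> ?sep {c, y} = {}"
    using pairwiseD[OF star[unfolded star_centre_def] \<open>x \<in> S\<close> \<open>y \<in> S\<close> \<open>x \<noteq> y\<close>]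
    by (simp add: disjnt_def)
  then have "?sep {x, y} = ?sep {c, x} \<union> ?sep {c, y}"
    using tree_separating_edges_eq_splits[OF tree \<open>c \<in> verts T\<close>, of "{x, y}"] in_verts
    by (auto simp: separating_edges_pair[of _ c] splits_pair)
  moreover have "finite (?sep R)" for R
    using separating_edges_subset tree_finite_edges[OF tree] by (rule finite_subset)
  ultimately show ?thesis
    using in_verts \<open>c \<in> verts T\<close> disjoint by (simp add: r_weight sum.union_disjoint)
qed

lemma star_r_weights:
  fixes v :: "nat \<Rightarrow> 'v"
  assumes positive: "positive_weighted_tree T" and "2 \<le> k"
    and verts: "v ` {1..k+1} \<subseteq> verts T" and inj: "inj_on v {1..k+1}"
    and weight_relation:
      "(real k - 1) * r_weight T (v ` {1..k}) = (\<Sum>j=1..k. r_weight T (v ` {1..k+1} - {v j}))"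
  shows "i \<in> {1..k} \<Longrightarrow> r_weight T {v i, v (k + 1)} =
      r_weight T (v ` {1..k}) - r_weight T (v ` {1..k+1} - {v i})"
    and "1 \<le> i \<Longrightarrow> i < j \<Longrightarrow> j \<le> k \<Longrightarrow> r_weight T {v i, v j} =
      2 * r_weight T (v ` {1..k}) - r_weight T (v ` {1..k+1} - {v i})
        - r_weight T (v ` {1..k+1} - {v j})"
proof -
  define S where "S = v ` {1..k}"
  define c where "c = v (k + 1)"
  have image_v: "v ` {1..k+1} = insert c S"
    by (simp add: atLeastAtMostSuc_conv S_def c_def)
  then have S_verts: "S \<subseteq> verts T" and "c \<in> verts T"
    using verts by simp_all
  have inj_S: "inj_on v {1..k}" and "c \<notin> S"
    using inj by (auto simp: S_def c_def intro: inj_on_subset dest: inj_onD)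
  have card_S: "card S = k"
    using inj_S by (simp add: S_def card_image)
  then have "2 \<le> card S" using \<open>2 \<le> k\<close> by simp
  have "(\<Sum>j=1..k. r_weight T (insert c S - {v j})) = (\<Sum>x\<in>S. r_weight T (insert c S - {x}))"
    unfolding S_def by (subst sum.reindex[OF inj_S]) simp
  then have star: "star_centre (edges T) c S"
    using weight_relation
      star_centre_iff_sum_r_weight[OF positive S_verts \<open>2 \<le> card S\<close> \<open>c \<in> verts T\<close> \<open>c \<notin> S\<close>]
    unfolding image_v card_S S_def[symmetric] by simp
  have spoke: "r_weight T {c, v i} = r_weight T S - r_weight T (insert c S - {v i})"
    if "i \<in> {1..k}" for i
  proof -
    have "v i \<in> S" using that by (simp add: S_def)
    with positive S_verts \<open>2 \<le> card S\<close> \<open>c \<in> verts T\<close> \<open>c \<notin> S\<close> star show ?thesis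
      by (rule star_centre_r_weight_spoke)
  qed
  then show "i \<in> {1..k} \<Longrightarrow> r_weight T {v i, v (k + 1)} =
      r_weight T (v ` {1..k}) - r_weight T (v ` {1..k+1} - {v i})"
    unfolding image_v S_def[symmetric] c_def[symmetric] by (simp add: insert_commute)
  assume ij: "1 \<le> i" "i < j" "j \<le> k"
  then have "v i \<in> S" "v j \<in> S" "v i \<noteq> v j"
    using inj by (auto simp: S_def dest: inj_onD)
  then have "r_weight T {v i, v j} = r_weight T {c, v i} + r_weight T {c, v j}"
    by (rule star_centre_r_weight_pair[OF positive S_verts \<open>c \<in> verts T\<close> star])
  with ij show "r_weight T {v i, v j} =
      2 * r_weight T (v ` {1..k}) - r_weight T (v ` {1..k+1} - {v i})
        - r_weight T (v ` {1..k+1} - {v j})"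
    unfolding image_v S_def[symmetric] by (simp add: spoke)
qed

section \<open>Realized families\<close>

lemma labeled_inj_on_comp:
  assumes "labeled m T" and "inj_on a A" and "a ` A \<subseteq> {1..m}"
  shows "inj_on (\<lambda>i. lab T (a i)) A"
proof -
  have "inj_on (lab T) (a ` A)"
    using assms(1,3) unfolding labeled_def by (blast intro: inj_on_subset)
  with assms(2) show ?thesis
    using comp_inj_on[of a A "lab T"] by (simp add: comp_def)
qed

lemma realizes_index_pos:
  assumes "realizes m T F" and "(I, d) \<in> F" and "I \<subseteq> {1..m}" and "2 \<le> card I"
  shows "0 < d"
proof -
  have positive: "positive_weighted_tree T" and labeled: "labeled m T"
    and d: "d = r_weight T (lab T ` I)"
    using assms(1,2) by (auto simp: realizes_def)
  have "inj_on (lab T) I" "lab T ` I \<subseteq> verts T"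
    using labeled assms(3) unfolding labeled_def by (auto intro: inj_on_subset)
  then show ?thesis
    unfolding d using assms(4) by (intro r_weight_pos[OF positive]) (simp_all add: card_image)
qed

lemma positive_treelike_iff_realizes:
  assumes "\<And>I d. (I, d) \<in> F \<Longrightarrow> I \<subseteq> {1..m} \<and> 2 \<le> card I"
  shows "positive_treelike m F \<longleftrightarrow> (\<exists>T :: nat labeled_tree. realizes m T F)"
proof -
  have "\<forall>(I, d)\<in>F. 0 < d" if "realizes m T F" for T :: "nat labeled_tree"
    using realizes_index_pos[OF that] assms by auto
  then show ?thesis unfolding positive_treelike_def by blast
qed

lemma subset_family_subset_extended_family: "subset_family m k D \<subseteq> extended_family m k D a"
  by (auto simp: extended_family_def)

lemma extended_family_index:
  assumes "(I, d) \<in> extended_family m k D a" and "2 \<le> k"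
    and range: "a ` {1..k+1} \<subseteq> {1..m}" and inj: "inj_on a {1..k+1}"
  shows "I \<subseteq> {1..m} \<and> 2 \<le> card I"
proof -
  have pair_index: "{a i, a j} \<subseteq> {1..m} \<and> 2 \<le> card {a i, a j}"
    if "i \<in> {1..k+1}" "j \<in> {1..k+1}" "i \<noteq> j" for i j
    using range inj_on_eq_iff[OF inj that(1,2)] that by (auto simp: image_subset_iff)
  from assms(1) consider (old) "(I, d) \<in> subset_family m k D"
    | (spoke) i where "i \<in> {1..k}" "I = {a i, a (k + 1)}"
    | (pair) i j where "1 \<le> i" "i < j" "j \<le> k" "I = {a i, a j}"
    unfolding extended_family_def by blast
  then show ?thesis
  proof cases
    case old
    then show ?thesis using assms(2) by (auto simp: subset_family_def)
  next
    case spoke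
    then show ?thesis using pair_index[of i "k + 1"] by simp
  next
    case pair
    then show ?thesis using pair_index[of i j] by simp
  qed
qed

lemma realizes_subset_family_r_weights:
  assumes "realizes m T (subset_family m k D)"
    and range: "a ` {1..k+1} \<subseteq> {1..m}" and inj: "inj_on a {1..k+1}"
  defines "v \<equiv> \<lambda>i. lab T (a i)"
  shows "D (a ` {1..k}) = r_weight T (v ` {1..k})"
    and "i \<in> {1..k} \<Longrightarrow> D (a ` {1..k+1} - {a i}) = r_weight T (v ` {1..k+1} - {v i})"
proof -
  have D_image: "D (a ` J) = r_weight T (v ` J)" if "J \<subseteq> {1..k+1}" "card J = k" for J
  proof -
    have "a ` J \<subseteq> {1..m}" "card (a ` J) = k"
      using that range inj by (auto simp: card_image inj_on_subset)
    then show ?thesis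
      using assms(1) unfolding realizes_def subset_family_def v_def by (auto simp: image_image)
  qed
  show "D (a ` {1..k}) = r_weight T (v ` {1..k})"
    by (rule D_image) auto
  assume i: "i \<in> {1..k}"
  have "inj_on v {1..k+1}"
    using assms(1) labeled_inj_on_comp[OF _ inj range] unfolding v_def realizes_def by blast
  then have "v ` ({1..k+1} - {i}) = v ` {1..k+1} - {v i}"
    using i by (subst inj_on_image_set_diff) auto
  moreover have "a ` ({1..k+1} - {i}) = a ` {1..k+1} - {a i}"
    using i by (subst inj_on_image_set_diff[OF inj]) auto
  moreover have "card ({1..k+1} - {i}) = k" using i by simp
  ultimately show "D (a ` {1..k+1} - {a i}) = r_weight T (v ` {1..k+1} - {v i})"
    using D_image[of "{1..k+1} - {i}"] by simp
qed

lemma realizes_extended_family_iff: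
  assumes "2 \<le> k" and range: "a ` {1..k+1} \<subseteq> {1..m}" and inj: "inj_on a {1..k+1}"
    and weight_relation: "(real k - 1) * D (a ` {1..k}) = (\<Sum>j=1..k. D (a ` {1..k+1} - {a j}))"
  shows "realizes m T (subset_family m k D) \<longleftrightarrow> realizes m T (extended_family m k D a)"
proof
  assume "realizes m T (extended_family m k D a)"
  then show "realizes m T (subset_family m k D)"
    using subset_family_subset_extended_family unfolding realizes_def by blast
next
  assume realizes: "realizes m T (subset_family m k D)"
  define v where "v i = lab T (a i)" for i
  have positive: "positive_weighted_tree T" and labeled: "labeled m T"
    using realizes by (auto simp: realizes_def)
  have inj_v: "inj_on v {1..k+1}"
    unfolding v_def using labeled_inj_on_comp[OF labeled inj range] .
  have verts: "v ` {1..k+1} \<subseteq> verts T"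
    using range labeled unfolding v_def labeled_def by blast
  note D_eq = realizes_subset_family_r_weights[OF realizes range inj, folded v_def]
  have "(real k - 1) * r_weight T (v ` {1..k}) = (\<Sum>j=1..k. r_weight T (v ` {1..k+1} - {v j}))"
    using weight_relation by (simp only: D_eq cong: sum.cong)
  note star = star_r_weights[OF positive \<open>2 \<le> k\<close> verts inj_v this]
  have "D (a ` {1..k}) - D (a ` {1..k+1} - {a i}) = r_weight T {v i, v (k + 1)}"
    if "i \<in> {1..k}" for i
    by (simp only: star(1) D_eq that)
  moreover have "2 * D (a ` {1..k}) - D (a ` {1..k+1} - {a i}) - D (a ` {1..k+1} - {a j}) =
      r_weight T {v i, v j}" if "1 \<le> i" "i < j" "j \<le> k" for i j
  proof -
    have "i \<in> {1..k}" "j \<in> {1..k}" using that by auto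
    then show ?thesis by (simp only: star(2) D_eq that)
  qed
  ultimately have "\<forall>(I, d)\<in>extended_family m k D a. d = r_weight T (lab T ` I)"
    using realizes unfolding extended_family_def realizes_def v_def by auto
  with realizes show "realizes m T (extended_family m k D a)"
    by (simp add: realizes_def)
qed

theorem mainTheorem3:
  fixes m k :: nat and D :: "nat set \<Rightarrow> real" and a :: "nat \<Rightarrow> nat"
  assumes "2 \<le> k" and "k < m"
    and "\<And>I. I \<subseteq> {1..m} \<Longrightarrow> card I = k \<Longrightarrow> 0 < D I"
    and "a ` {1..k+1} \<subseteq> {1..m}" and "inj_on a {1..k+1}"
    and "(real k - 1) * D (a ` {1..k}) = (\<Sum>j=1..k. D (a ` {1..k+1} - {a j}))"
  shows "(positive_treelike m (subset_family m k D) \<longleftrightarrow>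
            positive_treelike m (extended_family m k D a)) \<and>
         (\<forall>T :: 'v labeled_tree.
            realizes m T (subset_family m k D) \<longleftrightarrow> realizes m T (extended_family m k D a))"
proof (intro conjI allI)
  note same = realizes_extended_family_iff[OF assms(1,4-6)]
  show "realizes m T (subset_family m k D) \<longleftrightarrow> realizes m T (extended_family m k D a)"
    for T :: "'v labeled_tree"
    by (rule same)
  have "I \<subseteq> {1..m} \<and> 2 \<le> card I" if "(I, d) \<in> extended_family m k D a" for I d
    using extended_family_index[OF that assms(1,4,5)] .
  moreover from this have "I \<subseteq> {1..m} \<and> 2 \<le> card I" if "(I, d) \<in> subset_family m k D" for I d
    using that subset_family_subset_extended_family by blast
  ultimately show "positive_treelike m (subset_family m k D) \<longleftrightarrow>
      positive_treelike m (extended_family m k D a)"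
    by (simp only: positive_treelike_iff_realizes same)
qed

end
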